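(* Let $l\ge 1$ and let $2\le m_1\le \cdots \le m_l$ be integers. Let $\theta=\theta(m_1^{[2]},\dots,m_l^{[2]})$ be the bridge graph consisting of $2l$ internally disjoint $(u,v)$-paths, two of length $m_i$ for each $i$. If $\theta$ is not one of the following graphs: $K_{2,s}=\theta(2^{[s]})$ with even $s\ge 4$; (1) $\theta(4t^{[3t+2]}, (4t+2)^{[t]})$ with $t\ge 1$; (2a) $\theta(2t-2, (4t-2)^{[3t-1]})$ with $t\ge 2$; (2b) $\theta(2, 4^{[3]}, 6)$, $\theta(4, 8^{[5]}, 10^{[2]})$, $\theta(6, 12^{[7]}, 14^{[3]})$; (3a) $\theta(4t-2-2p, 2p, (4t-4)^{[t]}, (4t-2)^{[t-2]})$ with integers $2\le t\le p\le \frac{5t-2}{4}$; (3b) $\theta(4t-2-2p, 2p-2, (4t-4)^{[t-1]}, (4t-2)^{[t-1]})$ with integers $2\le t\le p\le \frac{5t}{4}$; (4) $\theta(2p, 4s-6-2p, 2s-4, (4s-6)^{[s-3]})$ with integers $s\ge 4$ and $\frac{2s-3}{8}\le p\le \frac{6s-5}{8}$; then $\chi_{la}(\theta)=3$.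
   Context: For a connected graph $G=(V,E)$, a local antimagic labeling is a bijection $f:E\to\{1,\dots,|E|\}$ such that $f^+(x)\neq f^+(y)$ for adjacent vertices $x,y$, where $f^+(x)=\sum_{e\ni x} f(e)$. The number of distinct values of $f^+$ is $c(f)$, and $\chi_{la}(G)$ is the minimum of $c(f)$ over all local antimagic labelings of $G$. A bridge graph $\theta(a_1,\dots,a_s)$ consists of two vertices $u,v$ joined by $s$ internally disjoint $(u,v)$-paths of lengths $a_1,\dots,a_s$ (the graph depends only on the multiset of lengths). The notation $a^{[n]}$ denotes $n$ entries equal to $a$ (for $n=0$, no entries). *)

theory Defs
  imports Complex_Main "HOL-Library.Multiset" "HOL-Library.Extended_Nat"
begin

text \<open>
  A finite simple graph is given by its vertex set \<open>V\<close> and its set \<open>E\<close> of edges, each edge being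
  a two-element subset of \<open>V\<close>.
\<close>

definition vertex_sum :: "'a set set \<Rightarrow> ('a set \<Rightarrow> nat) \<Rightarrow> 'a \<Rightarrow> nat" where
  "vertex_sum E f x = (\<Sum>e\<in>{e \<in> E. x \<in> e}. f e)"

definition local_antimagic_labeling :: "'a set \<Rightarrow> 'a set set \<Rightarrow> ('a set \<Rightarrow> nat) \<Rightarrow> bool" where
  "local_antimagic_labeling V E f \<longleftrightarrow>
     bij_betw f E {1..card E} \<and>
     (\<forall>x\<in>V. \<forall>y\<in>V. {x, y} \<in> E \<longrightarrow> vertex_sum E f x \<noteq> vertex_sum E f y)"

definition num_colors :: "'a set \<Rightarrow> 'a set set \<Rightarrow> ('a set \<Rightarrow> nat) \<Rightarrow> nat" where
  "num_colors V E f = card (vertex_sum E f ` V)"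

text \<open>
  For a graph without any local antimagic labeling (such as a single edge) the infimum is
  \<open>\<infinity>\<close>; a finite value is attained by some labeling and is then the minimum.
\<close>

definition chi_la :: "'a set \<Rightarrow> 'a set set \<Rightarrow> enat" where
  "chi_la V E = (INF f \<in> {f. local_antimagic_labeling V E f}. enat (num_colors V E f))"

text \<open>A path is the list of its vertices in order; its length is its number of edges.\<close>

definition path_between :: "'a \<Rightarrow> 'a \<Rightarrow> 'a list \<Rightarrow> bool" where
  "path_between u v p \<longleftrightarrow> p \<noteq> [] \<and> hd p = u \<and> last p = v \<and> distinct p"

definition path_edges :: "'a list \<Rightarrow> 'a set set" where
  "path_edges p = {{p ! i, p ! Suc i} | i. Suc i < length p}"

definition path_length :: "'a list \<Rightarrow> nat" where
  "path_length p = length p - 1"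

text \<open>
  \<open>is_bridge_graph V E M\<close> says that the graph \<open>(V, E)\<close> is \<open>\<theta>(a\<^sub>1, \<dots>, a\<^sub>s)\<close>, where \<open>M\<close> is the
  multiset of the lengths \<open>a\<^sub>1, \<dots>, a\<^sub>s\<close>. Being a predicate on arbitrary graphs, it is
  invariant under graph isomorphism.
\<close>

definition is_bridge_graph :: "'a set \<Rightarrow> 'a set set \<Rightarrow> nat multiset \<Rightarrow> bool" where
  "is_bridge_graph V E M \<longleftrightarrow>
     (\<exists>u v P. u \<noteq> v \<and> finite P \<and>
        (\<forall>p\<in>P. path_between u v p) \<and>
        (\<forall>p\<in>P. \<forall>q\<in>P. p \<noteq> q \<longrightarrow> set p \<inter> set q = {u, v}) \<and>
        image_mset path_length (mset_set P) = M \<and>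
        V = {u, v} \<union> (\<Union>p\<in>P. set p) \<and>
        E = (\<Union>p\<in>P. path_edges p))"

end

theory Submission
  imports Defs
begin

text \<open>
  Upper bound. With \<open>2M\<close> edges, the even labels in the order \<open>2M, 2, 2M - 2, 4, \<dots>\<close> have consecutive
  sums \<open>2M + 2\<close> and \<open>2M\<close> alternately, and so do the odd labels obtained by \<open>a \<mapsto> 2M + 1 - a\<close>. Cut
  both sequences into segments of lengths \<open>m\<^sub>1, \<dots>, m\<^sub>l\<close> and put the two \<open>i\<close>-th segments on the two
  paths of length \<open>m\<^sub>i\<close>. The paths of a pair contribute \<open>2M + 1\<close> to both \<open>u\<close> and \<open>v\<close>, which therefore
  share the third colour \<open>l (2M + 1)\<close>.

  Lower bound. A labeling with two colours \<open>x\<close> (at \<open>u\<close>) and \<open>y\<close> forces all lengths to be even, say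
  \<open>2 h\<^sub>p\<close>, and gives \<open>v\<close> the colour \<open>x\<close>. Counting gives \<open>y = 2N + 1\<close> with \<open>N = \<Sum> h\<^sub>p\<close>, and
  \<open>d = x - y > 0\<close>. Every second label along a path forms an arithmetic progression with difference
  \<open>d\<close>, so the two end labels of a path add up to \<open>y - (h\<^sub>p - 1) d\<close>. Labels that are not end labels come
  in pairs with sum \<open>x\<close>; hence the \<open>2s\<close> end labels are \<open>1, \<dots>, d\<close> and a set \<open>R\<close> that is invariant under
  \<open>a \<mapsto> x - a\<close>. Their total is \<open>2x\<close>, so \<open>(4 - |R|) x = d (d + 1)\<close> and \<open>|R| \<le> 3\<close>. Paths with both ends
  in \<open>{1..d}\<close> have \<open>h\<^sub>p\<close> determined up to one unit, and since every length occurs an even number of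
  times, \<open>|R| = 0\<close> leads to family (1), \<open>|R| = 2\<close> to family (3b) with \<open>p = t\<close>, and \<open>|R| = 1, 3\<close> are
  impossible.
\<close>

section \<open>Two colours: the end labels\<close>

lemma count_image_mset_set:
  "finite A \<Longrightarrow> count (image_mset f (mset_set A)) c = card {a \<in> A. f a = c}"
  by (simp add: count_image_mset Int_def vimage_def conj_commute)

lemma image_mset_two_values:
  assumes "finite A" "\<And>a. a \<in> A \<Longrightarrow> f a = b \<or> f a = c" "b \<noteq> c"
  shows "image_mset f (mset_set A) =
    replicate_mset (card {a \<in> A. f a = b}) b + replicate_mset (card {a \<in> A. f a = c}) c"
proof (rule multiset_eqI)
  fix z
  have "{a \<in> A. f a = z} = {}" if "z \<noteq> b" "z \<noteq> c"
    using assms(2) that by auto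
  then show "count (image_mset f (mset_set A)) z = count (replicate_mset (card {a \<in> A. f a = b}) b
      + replicate_mset (card {a \<in> A. f a = c}) c) z"
    using assms(1,3) by (auto simp: count_image_mset_set simp del: count_image_mset)
qed

text \<open>Two unknown multiplicities are determined by their total and by the sum of the values.
  This recovers how often each half-length occurs from the number of paths and from
  \<open>N\<close>.\<close>

lemma card_sum_two_values:
  fixes f :: "'b \<Rightarrow> nat"
  assumes "finite A" "\<And>a. a \<in> A \<Longrightarrow> f a = b \<or> f a = Suc b"
  shows "card {a \<in> A. f a = b} + card {a \<in> A. f a = Suc b} = card A"
    and "sum f A = b * card A + card {a \<in> A. f a = Suc b}"
proof -
  have A: "A = {a \<in> A. f a = b} \<union> {a \<in> A. f a = Suc b}"
    using assms(2) by auto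
  show 1: "card {a \<in> A. f a = b} + card {a \<in> A. f a = Suc b} = card A"
    by (subst A, subst card_Un_disjoint) (use assms(1) in auto)
  have "sum f A = sum f {a \<in> A. f a = b} + sum f {a \<in> A. f a = Suc b}"
    by (subst A, subst sum.union_disjoint) (use assms(1) in auto)
  then show "sum f A = b * card A + card {a \<in> A. f a = Suc b}"
    unfolding 1[symmetric] by (simp add: algebra_simps)
qed

lemma even_card_of_fibres:
  assumes "finite A" "\<And>n. even (card {a \<in> A. g a = n})"
  shows "even (card A)"
proof -
  have "card A = (\<Sum>n\<in>g ` A. card {a \<in> A. g a = n})"
    using sum.group[OF assms(1) finite_imageI[OF assms(1)] subset_refl,
        where g=g and h="\<lambda>_. 1::nat"] by simp
  then show ?thesis
    using assms(2) by (simp add: dvd_sum)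
qed

text \<open>The path \<open>p\<close> has length \<open>2 * h p\<close>, and \<open>e p True\<close>, \<open>e p False\<close> are the labels of its edges at
  \<open>u\<close> and \<open>v\<close>. The colour of \<open>u\<close> and \<open>v\<close> is \<open>2 * N + 1 + d\<close>, the other one is \<open>2 * N + 1\<close>. The
  labels up to \<open>d\<close> have no partner at an inner vertex of the first colour, which is \<open>low\<close>.\<close>

locale end_labels =
  fixes P :: "'b set" and h :: "'b \<Rightarrow> nat" and e :: "'b \<Rightarrow> bool \<Rightarrow> int" and d N s :: int
  assumes finite_P: "finite P"
    and s_eq: "s = int (card P)" and s_ge: "s \<ge> 4"
    and N_eq: "N = int (sum h P)"
    and h_pos: "p \<in> P \<Longrightarrow> h p \<ge> 1"
    and e_inj: "inj_on (\<lambda>(p, c). e p c) (P \<times> UNIV)"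
    and e_bounds: "p \<in> P \<Longrightarrow> 1 \<le> e p c \<and> e p c \<le> 2 * N"
    and e_add: "p \<in> P \<Longrightarrow> e p True + e p False = 2 * N + 1 - (int (h p) - 1) * d"
    and e_sum: "(\<Sum>p\<in>P. e p c) = 2 * N + 1 + d"
    and d_pos: "d > 0"
    and low: "1 \<le> a \<Longrightarrow> a \<le> d \<Longrightarrow> \<exists>p\<in>P. \<exists>c. e p c = a"
    and refl: "p \<in> P \<Longrightarrow> e p c > d \<Longrightarrow> \<exists>q\<in>P. \<exists>c'. e q c' = 2 * N + 1 + d - e p c"
    and parity: "even (card {p \<in> P. h p = n})"
begin

section \<open>The end labels above \<open>d\<close> and their number\<close>

definition x :: int where "x = 2 * N + 1 + d"

definition R :: "int set" where "R = {a. a > d \<and> (\<exists>p\<in>P. \<exists>c. e p c = a)}"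

lemma e_eq_iff: "p \<in> P \<Longrightarrow> q \<in> P \<Longrightarrow> e p c = e q c' \<longleftrightarrow> p = q \<and> c = c'"
  using inj_onD[OF e_inj, of "(p, c)" "(q, c')"] by auto

lemma e_add': "p \<in> P \<Longrightarrow> e p c + e p (\<not> c) = x - int (h p) * d"
  using e_add[of p] by (cases c) (auto simp: x_def algebra_simps)

lemma R_refl: "a \<in> R \<Longrightarrow> x - a \<in> R"
  using refl e_bounds unfolding R_def x_def
  by (smt (verit, best) mem_Collect_eq)

lemma R_E:
  assumes "a \<in> R"
  obtains p c where "p \<in> P" "e p c = a"
  using assms unfolding R_def by blast

lemma not_R_bound: "p \<in> P \<Longrightarrow> e p c \<notin> R \<Longrightarrow> e p c \<le> d"
  unfolding R_def by force

lemma ends_eq: "(\<lambda>(p, c). e p c) ` (P \<times> UNIV) = {1..d} \<union> R"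
proof
  show "(\<lambda>(p, c). e p c) ` (P \<times> UNIV) \<subseteq> {1..d} \<union> R"
    using e_bounds unfolding R_def by force
  show "{1..d} \<union> R \<subseteq> (\<lambda>(p, c). e p c) ` (P \<times> UNIV)"
    using low unfolding R_def by force
qed

lemma finite_R: "finite R"
  using finite_imageI[of "P \<times> (UNIV :: bool set)" "\<lambda>(p, c). e p c"] finite_P ends_eq by auto

lemma R_disj: "{1..d} \<inter> R = {}"
  unfolding R_def by auto

text \<open>The \<open>2 * s\<close> end labels are distinct and include all of \<open>1..d\<close>;
  \<open>R\<close> is what remains.\<close>

lemma card_R: "int (card R) = 2 * s - d"
proof -
  have "card ({1..d} \<union> R) = card (P \<times> (UNIV :: bool set))"
    unfolding ends_eq[symmetric] by (rule card_image[OF e_inj])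
  moreover have "card ({1..d} \<union> R) = nat d + card R"
    using R_disj finite_R by (simp add: card_Un_disjoint)
  ultimately show ?thesis
    using s_eq d_pos by (simp add: card_cartesian_product)
qed

text \<open>Double counting of the end labels: they sum to \<open>2 * x\<close>, while \<open>R\<close>, being symmetric about
  \<open>x / 2\<close>, has mean \<open>x / 2\<close>.\<close>

lemma ends_equation: "(4 - int (card R)) * x = d * (d + 1)"
proof -
  have "\<Sum>R = (\<Sum>a\<in>R. x - a)"
    by (rule sum.reindex_bij_witness[where i="\<lambda>a. x - a" and j="\<lambda>a. x - a"]) (auto simp: R_refl)
  then have 1: "2 * \<Sum>R = int (card R) * x"
    by (simp add: sum_subtractf)
  have 2: "2 * \<Sum>{1..d} = d * (d + 1)"
  proof -
    have "{1..d} = int ` {1..nat d}"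
      using d_pos by (simp add: image_int_atLeastAtMost)
    then have "\<Sum>{1..d} = (\<Sum>i=1..nat d. int i)"
      by (simp add: sum.reindex)
    also have "2 * \<dots> = int (nat d) * (int (nat d) + 1)"
      using double_gauss_sum_from_Suc_0[of "nat d", where 'a=int] by simp
    finally show ?thesis using d_pos by simp
  qed
  have "\<Sum>({1..d} \<union> R) = (\<Sum>(p, c)\<in>P \<times> UNIV. e p c)"
    unfolding ends_eq[symmetric] by (subst sum.reindex[OF e_inj]) (simp add: case_prod_beta)
  also have "\<dots> = (\<Sum>p\<in>P. \<Sum>c\<in>UNIV. e p c)"
    by (simp add: sum.cartesian_product)
  also have "\<dots> = (\<Sum>p\<in>P. e p False) + (\<Sum>p\<in>P. e p True)"
    by (simp add: UNIV_bool sum.distrib)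
  also have "\<dots> = 2 * x"
    using e_sum unfolding x_def by simp
  finally have "\<Sum>{1..d} + \<Sum>R = 2 * x"
    using R_disj finite_R by (simp add: sum.union_disjoint)
  with 1 2 show ?thesis by (simp add: algebra_simps)
qed

text \<open>\<open>x\<close> and \<open>d * (d + 1)\<close> are positive, so
  \<open>ends_equation\<close> forces its first factor to be positive.\<close>

lemma card_R_le: "card R \<le> 3"
proof -
  have "x > 0"
    using N_eq d_pos unfolding x_def by linarith
  have "(4 - int (card R)) * x > 0"
    unfolding ends_equation using d_pos by simp
  with \<open>x > 0\<close> have "4 - int (card R) > 0"
    by (simp add: zero_less_mult_iff)
  then show ?thesis by simp
qed

text \<open>Both end labels lie in \<open>{1..d}\<close> and differ, so their sum is at least
  \<open>1 + 2\<close> and at most \<open>d + (d - 1)\<close>.\<close>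

lemma normal_bounds:
  assumes "p \<in> P" "\<And>c. e p c \<notin> R"
  shows "3 \<le> x - int (h p) * d" "x - int (h p) * d \<le> 2 * d - 1"
proof -
  have *: "e p True \<noteq> e p False"
    using e_eq_iff[OF assms(1,1)] by simp
  have "1 \<le> e p c \<and> e p c \<le> d" for c
    using not_R_bound[OF assms(1) assms(2)] e_bounds[OF assms(1)] by blast
  from * this[of True] this[of False] e_add'[OF assms(1), of True]
  show "3 \<le> x - int (h p) * d" "x - int (h p) * d \<le> 2 * d - 1" by auto
qed

text \<open>An even fibre of \<open>h\<close> cannot be a singleton. The second path is played off
  against paths that carry a label from \<open>R\<close>.\<close>

lemma same_h:
  assumes "p \<in> P"
  obtains q where "q \<in> P" "q \<noteq> p" "h q = h p"
proof -
  have "{q \<in> P. h q = h p} \<noteq> {p}"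
    using parity[of "h p"] by (metis card.empty card_insert_disjoint empty_iff finite.emptyI odd_one One_nat_def)
  then show thesis using that assms by blast
qed

lemma even_s: "even s"
  unfolding s_eq using even_card_of_fibres[OF finite_P parity] by simp

text \<open>A coarse division by \<open>d\<close>: the bounds place \<open>(g - n) * d\<close>
  strictly between \<open>- d\<close> and \<open>2 * d\<close>. With \<open>x = g * d + a\<close>
  and \<open>normal_bounds\<close>, only two half-lengths remain for a path whose end labels are at
  most \<open>d\<close>.\<close>

lemma window:
  fixes a g n :: int
  assumes "3 \<le> g * d + a - n * d" "g * d + a - n * d \<le> 2 * d - 1" "0 \<le> a" "a \<le> d + 2"
  shows "n = g \<or> n = g - 1"
proof -
  have 1: "(g - n) * d > -1 * d"
    using assms by (simp add: algebra_simps)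
  have 2: "(g - n) * d < 2 * d"
    using assms by (simp add: algebra_simps)
  from 1 2 have "-1 < g - n" "g - n < 2"
    using d_pos mult_less_cancel_right_pos by blast+
  then show ?thesis by linarith
qed


text \<open>Here \<open>d = 2 * s\<close> and \<open>4 * x = d * (d + 1)\<close>. As
  \<open>d\<close> is even, \<open>x\<close> is odd, which makes \<open>s / 2 = 2 * t + 1\<close>
  odd. Every path is then covered by \<open>window\<close>, and the multiplicities follow from
  \<open>s\<close> and \<open>N\<close>. The result is family (1) with halved lengths.\<close>

lemma card_R_0:
  assumes "card R = 0"
  shows "\<exists>t\<ge>1. image_mset h (mset_set P) =
    replicate_mset (3 * t + 2) (2 * t) + replicate_mset t (2 * t + 1)"
proof -
  have R: "R = {}"
    using assms finite_R by simp
  obtain \<sigma> where \<sigma>: "s = 2 * \<sigma>"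
    using even_s by blast
  have d: "d = 4 * \<sigma>"
    using card_R assms \<sigma> by simp
  have x: "x = \<sigma> * (4 * \<sigma> + 1)"
    using ends_equation assms d by simp
  have "odd x"
    using d unfolding x_def by simp
  then have "odd \<sigma>"
    unfolding x by simp
  then obtain t' where t': "\<sigma> = 2 * t' + 1"
    by (rule oddE)
  have "t' \<ge> 1"
    using s_ge \<sigma> t' by simp
  define t where "t = nat t'"
  have t: "t' = int t" "t \<ge> 1"
    using \<open>t' \<ge> 1\<close> unfolding t_def by auto
  have d: "d = 8 * int t + 4" and s: "s = 4 * int t + 2"
    using d t' t \<sigma> by auto
  have x': "x = (2 * int t + 1) * d + (2 * int t + 1)"
    using x d t' t(1) by (simp add: algebra_simps)
  have N: "N = 8 * int t * int t + 5 * int t"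
    using x' unfolding x_def unfolding d by (simp add: algebra_simps)
  have two: "h p = 2 * t \<or> h p = Suc (2 * t)" if "p \<in> P" for p
  proof -
    have "int (h p) = 2 * int t + 1 \<or> int (h p) = 2 * int t + 1 - 1"
      by (rule window[where a="2 * int t + 1"])
        (use normal_bounds[OF that] R x' d in auto)
    then show ?thesis by linarith
  qed
  have cardP: "card P = 4 * t + 2"
    using s s_eq by simp
  note sums = card_sum_two_values[where f=h, OF finite_P two]
  have "int (sum h P) = 8 * int t * int t + 5 * int t"
    using N N_eq by simp
  then have "sum h P = 8 * t * t + 5 * t"
    by (metis (mono_tags, opaque_lifting) of_nat_add of_nat_eq_iff of_nat_mult of_nat_numeral)
  then have n1: "card {p \<in> P. h p = Suc (2 * t)} = t"
    using sums(2) cardP by (simp add: algebra_simps)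
  then have n0: "card {p \<in> P. h p = 2 * t} = 3 * t + 2"
    using sums(1) cardP by simp
  show ?thesis
    using image_mset_two_values[where f=h, OF finite_P two] n0 n1 t(2) by (intro exI[of _ t]) simp
qed

text \<open>By symmetry the only element of \<open>R\<close> is \<open>x / 2\<close>. A second path
  with the half-length of the one ending there has both ends in \<open>{1..d}\<close>, which bounds
  the end sum of both paths by \<open>2 * d - 1\<close>. Then \<open>3 * x = d * (d + 1)\<close>
  leaves only small \<open>s\<close>.\<close>

lemma card_R_1: "card R \<noteq> 1"
proof
  assume one: "card R = 1"
  then obtain r where R: "R = {r}"
    by (auto simp: card_1_singleton_iff)
  have r: "2 * r = x"
    using R_refl[of r] R by auto
  have d: "d = 2 * s - 1"
    using card_R one by simp
  have x: "3 * x = d * (d + 1)"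
    using ends_equation one by simp
  obtain p c where p: "p \<in> P" "e p c = r"
    using R_E[of r] R by auto
  obtain q where q: "q \<in> P" "q \<noteq> p" "h q = h p"
    using same_h[OF p(1)] .
  have "e q c' \<notin> R" for c'
    using e_eq_iff[OF q(1) p(1), of c' c] p q R by auto
  then have "x - int (h p) * d \<le> 2 * d - 1"
    using normal_bounds(2)[OF q(1)] q(3) by simp
  then have "r \<le> 2 * d - 2"
    using e_add'[OF p(1), of c] e_bounds[OF p(1), of "\<not> c"] p(2) by simp
  then have "d * (d + 1) < d * 12"
    using r x d_pos by linarith
  then have "d + 1 < 12"
    using d_pos by (simp add: mult_less_cancel_left_pos)
  then have "s < 6"
    using d by simp
  moreover obtain \<sigma> where "s = 2 * \<sigma>"
    using even_s by blast
  ultimately have "s = 4"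
    using s_ge by simp
  \<comment> \<open>Now \<open>d = 7\<close>, and \<open>3 * x = 56\<close> has no integer
    solution.\<close>
  then show False
    using d x by simp presburger
qed

text \<open>The two labels in \<open>R\<close> add up to \<open>x\<close> and sit on different paths
  \<open>p1\<close>, \<open>p2\<close>; with \<open>g = s - 1\<close> one has
  \<open>d = 2 * g\<close> and \<open>x = g * d + g\<close>. All other paths are covered by
  \<open>window\<close>, and evenness forces \<open>h p1 = h p2\<close>. The result is family (3b)
  for \<open>p = t\<close> with halved lengths.\<close>

lemma card_R_2:
  assumes two: "card R = 2"
  shows "\<exists>t\<ge>2. image_mset h (mset_set P) = {#t - 1, t - 1#} +
    replicate_mset (t - 1) (2 * t - 2) + replicate_mset (t - 1) (2 * t - 1)"
proof -
  obtain b b' where R: "R = {b, b'}" "b \<noteq> b'"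
    using two by (auto simp: card_2_iff)
  have bb: "b + b' = x"
    using R_refl[of b] R_refl[of b'] R by auto
  obtain t' where t': "s = 2 * t'"
    using even_s by blast
  define t where "t = nat t'"
  have t: "s = 2 * int t" "t \<ge> 2"
    using t' s_ge unfolding t_def by auto
  define g where "g = 2 * int t - 1"
  have d: "d = 2 * g"
    using card_R two t unfolding g_def by simp
  have x: "x = g * d + g"
    using ends_equation two unfolding d by (simp add: algebra_simps)
  have g: "g \<ge> 3"
    using t unfolding g_def by simp
  obtain p1 c1 where p1: "p1 \<in> P" "e p1 c1 = b"
    using R_E[of b] R by auto
  obtain p2 c2 where p2: "p2 \<in> P" "e p2 c2 = b'"
    using R_E[of b'] R by auto
  \<comment> \<open>The two ends of one path cannot add up to \<open>x\<close>, since
    \<open>e_add'\<close> subtracts the positive \<open>h p * d\<close>.\<close>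
  have ne: "p1 \<noteq> p2"
  proof
    assume "p1 = p2"
    then have "c2 = (\<not> c1)"
      using p1 p2 R(2) by (cases c1; cases c2) auto
    then have "int (h p1) * d = 0"
      using e_add'[OF p1(1), of c1] p1 p2 bb \<open>p1 = p2\<close> by simp
    then show False
      using h_pos[OF p1(1)] d_pos by simp
  qed
  have notin: "e p c \<notin> R" if "p \<in> P" "(p, c) \<noteq> (p1, c1)" "(p, c) \<noteq> (p2, c2)" for p c
    using e_eq_iff[OF that(1) p1(1), of c c1] e_eq_iff[OF that(1) p2(1), of c c2] that p1 p2 R
    by auto
  have o1: "1 \<le> e p1 (\<not> c1)" "e p1 (\<not> c1) \<le> d"
    using e_bounds[OF p1(1)] not_R_bound[OF p1(1) notin[OF p1(1)]] ne by auto
  have o2: "1 \<le> e p2 (\<not> c2)" "e p2 (\<not> c2) \<le> d"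
    using e_bounds[OF p2(1)] not_R_bound[OF p2(1) notin[OF p2(1)]] ne by auto
  have o12: "e p1 (\<not> c1) \<noteq> e p2 (\<not> c2)"
    using e_eq_iff[OF p1(1) p2(1)] ne by simp
  \<comment> \<open>As \<open>b + b' = x\<close>, the other ends of \<open>p1\<close> and
    \<open>p2\<close> add up like the ends of a single path of half-length
    \<open>h p1 + h p2\<close>.\<close>
  have hh: "int (h p1 + h p2) = g \<or> int (h p1 + h p2) = g - 1"
  proof (rule window[where a=g])
    have *: "x - int (h p1 + h p2) * d = e p1 (\<not> c1) + e p2 (\<not> c2)"
      using e_add'[OF p1(1), of c1] e_add'[OF p2(1), of c2] p1 p2 bb by (simp add: algebra_simps)
    then show "3 \<le> g * d + g - int (h p1 + h p2) * d"
      "g * d + g - int (h p1 + h p2) * d \<le> 2 * d - 1"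
      unfolding x using o1 o2 o12 by linarith+
  qed (use g d in auto)
  have normal: "h p = 2 * t - 2 \<or> h p = Suc (2 * t - 2)" if "p \<in> P" "p \<noteq> p1" "p \<noteq> p2" for p
  proof -
    have "int (h p) = g \<or> int (h p) = g - 1"
      by (rule window[where a=g]) (use normal_bounds[OF that(1) notin] that x d g in auto)
    then show ?thesis
      using t(2) unfolding g_def by linarith
  qed
  \<comment> \<open>If the half-lengths differed, each would recur on a path other than
    \<open>p1\<close> and \<open>p2\<close>, hence be at least \<open>2 * t - 2\<close>, and their
    sum would exceed \<open>g\<close>.\<close>
  have heq: "h p1 = h p2"
  proof (rule ccontr)
    assume neq: "h p1 \<noteq> h p2"
    obtain q1 where "q1 \<in> P" "q1 \<noteq> p1" "h q1 = h p1"
      using same_h[OF p1(1)] .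
    then have "h p1 \<ge> 2 * t - 2"
      using normal[of q1] neq by (cases "q1 = p2") auto
    moreover obtain q2 where "q2 \<in> P" "q2 \<noteq> p2" "h q2 = h p2"
      using same_h[OF p2(1)] .
    then have "h p2 \<ge> 2 * t - 2"
      using normal[of q2] neq by (cases "q2 = p1") auto
    ultimately show False
      using hh t(2) neq unfolding g_def by linarith
  qed
  \<comment> \<open>\<open>g\<close> is odd, so only the value \<open>g - 1\<close> of the sum is
    possible.\<close>
  then have h1: "h p1 = t - 1"
    using hh t(2) unfolding g_def by presburger
  define Q where "Q = P - {p1, p2}"
  have Q: "finite Q" "P = insert p1 (insert p2 Q)" "p1 \<notin> insert p2 Q" "p2 \<notin> Q"
    using finite_P p1 p2 ne unfolding Q_def by auto
  have cardP: "card P = 2 * t"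
    using t s_eq by simp
  then have cardQ: "card Q = 2 * t - 2"
    using Q by simp
  have normQ: "h p = 2 * t - 2 \<or> h p = Suc (2 * t - 2)" if "p \<in> Q" for p
    using normal that unfolding Q_def by simp
  note sums = card_sum_two_values[where f=h, OF Q(1) normQ]
  \<comment> \<open>The shift removes truncated subtraction on naturals from the count.\<close>
  obtain u where u: "t = u + 2"
    using t(2) by (metis add.commute le_Suc_ex)
  have "int (sum h P) = (4 * int t - 1) * (int t - 1)"
    using x unfolding x_def N_eq[symmetric] unfolding d g_def by (simp add: algebra_simps)
  then have "int (sum h P) = int ((4 * u + 7) * (u + 1))"
    unfolding u by (simp add: algebra_simps)
  then have "sum h P = (4 * u + 7) * (u + 1)"
    by (simp only: of_nat_eq_iff)
  moreover have "sum h P = 2 * (t - 1) + sum h Q"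
    unfolding Q(2) using Q heq h1 by simp
  ultimately have n1: "card {p \<in> Q. h p = Suc (2 * t - 2)} = t - 1"
    using sums(2) cardQ unfolding u by (simp add: algebra_simps)
  then have n0: "card {p \<in> Q. h p = 2 * t - 2} = t - 1"
    using sums(1) cardQ by simp
  have "image_mset h (mset_set Q) =
      replicate_mset (t - 1) (2 * t - 2) + replicate_mset (t - 1) (Suc (2 * t - 2))"
    using image_mset_two_values[where f=h, OF Q(1) normQ] n0 n1 by simp
  moreover have "Suc (2 * t - 2) = 2 * t - 1"
    using t(2) by simp
  moreover have "image_mset h (mset_set P) = {#t - 1, t - 1#} + image_mset h (mset_set Q)"
    unfolding Q(2) using Q heq h1 by simp
  ultimately show ?thesis
    using t(2) by (intro exI[of _ t]) (simp add: add.assoc)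
qed

text \<open>Here \<open>x = d * d + d\<close>, so a path with both ends outside \<open>R\<close> has
  half-length exactly \<open>d\<close>, while a path carrying a label from \<open>R\<close> does
  not. The three labels in \<open>R\<close> lie on three different paths, so exactly
  \<open>s - 3\<close> paths have half-length \<open>d\<close>, an odd number.\<close>

lemma card_R_3: "card R \<noteq> 3"
proof
  assume three: "card R = 3"
  obtain r b where R: "R = {r, b, x - b}" "2 * r = x" "r \<noteq> b"
  proof -
    obtain a1 a2 a3 where *: "R = {a1, a2, a3}" "a1 \<noteq> a2" "a1 \<noteq> a3" "a2 \<noteq> a3"
      using three by (auto simp: card_3_iff)
    have "x - a1 \<in> {a1, a2, a3}" "x - a2 \<in> {a1, a2, a3}" "x - a3 \<in> {a1, a2, a3}"
      using R_refl * by blast+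
    then consider "2 * a1 = x" "a3 = x - a2" | "2 * a2 = x" "a3 = x - a1" | "2 * a3 = x" "a2 = x - a1"
      using *(2-4) by (smt (verit) empty_iff insert_iff)
    then show thesis
      by cases (use * that[of a1 a2] that[of a2 a1] that[of a3 a1] in auto)
  qed
  have d: "d = 2 * s - 3"
    using card_R three by simp
  have d5: "d \<ge> 5"
    using d s_ge by simp
  have x: "x = d * d + d"
    using ends_equation three by (simp add: algebra_simps)
  have R_gt: "a > d" if "a \<in> R" for a
    using that unfolding R_def by simp
  have normal: "h p = nat d \<and> e p c < d" if "p \<in> P" "\<And>c. e p c \<notin> R" for p c
  proof -
    have "int (h p) = d \<or> int (h p) = d - 1"
      by (rule window[where a=d]) (use normal_bounds[OF that] x d5 in auto)
    \<comment> \<open>Half-length \<open>d - 1\<close> would give the end sum \<open>2 * d\<close>,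
      above the bound \<open>2 * d - 1\<close>.\<close>
    moreover have "int (h p) \<noteq> d - 1"
      using normal_bounds(2)[OF that] x by (auto simp: algebra_simps)
    ultimately have hp: "int (h p) = d" by simp
    then have "e p c < d"
      using e_add'[OF that(1), of c] e_bounds[OF that(1), of "\<not> c"] x by simp
    with hp show ?thesis by simp
  qed
  obtain p0 c0 where p0: "p0 \<in> P" "e p0 c0 = r"
    using R_E[of r] R by auto
  \<comment> \<open>Otherwise the one of \<open>u\<close>, \<open>v\<close> that does not see the label \<open>x - b\<close> sees at most \<open>r\<close>, at most \<open>d\<close>,
    and labels below \<open>d\<close> from the remaining paths, which add up to less than \<open>x\<close>.\<close>
  have apart: "e p0 (\<not> c0) \<noteq> b" if R: "R = {r, b, x - b}" "r \<noteq> b" for b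
  proof
    assume b: "e p0 (\<not> c0) = b"
    obtain p2 c2 where p2: "p2 \<in> P" "e p2 c2 = x - b"
      using R_E[of "x - b"] R by auto
    have ne: "p2 \<noteq> p0"
    proof
      assume "p2 = p0"
      then have "c2 = c0 \<or> c2 = (\<not> c0)" by auto
      then have "x - b = r \<or> x - b = b"
        using p0 p2 b \<open>p2 = p0\<close> by auto
      then show False
        using \<open>2 * r = x\<close> R(2) by auto
    qed
    have notin: "e p c \<notin> R" if "p \<in> P" "p \<noteq> p0" "(p, c) \<noteq> (p2, c2)" for p c
    proof -
      have "e p c \<noteq> r" "e p c \<noteq> b"
        using e_eq_iff[OF that(1) p0(1), of c] that(2) p0(2) b by auto
      moreover have "e p c \<noteq> x - b"
        using e_eq_iff[OF that(1) p2(1), of c c2] that(3) p2(2) by auto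
      ultimately show ?thesis
        using R(1) by auto
    qed
    define Q where "Q = P - {p0, p2}"
    have Q: "finite Q" "P = insert p0 (insert p2 Q)" "p0 \<notin> insert p2 Q" "p2 \<notin> Q"
      using finite_P p0 p2 ne unfolding Q_def by auto
    have cardQ: "int (card Q) = s - 2"
      using Q s_eq by simp
    \<comment> \<open>The label is \<open>r\<close> or \<open>b\<close>; in the second case
      \<open>r + b < x = 2 * r\<close>.\<close>
    have "e p0 (\<not> c2) \<le> r"
    proof (cases "c0 = c2")
      case True
      have "int (h p0) * d > 0"
        using h_pos[OF p0(1)] d_pos by simp
      then have "b < r"
        using e_add'[OF p0(1), of c0] p0 b \<open>2 * r = x\<close> by simp
      then show ?thesis
        using b True by simp
    next
      case False
      then have "(\<not> c2) = c0" by auto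
      then show ?thesis
        using p0 by simp
    qed
    moreover have "e p2 (\<not> c2) \<le> d"
      using not_R_bound[OF p2(1) notin[OF p2(1)]] ne by auto
    moreover have "(\<Sum>p\<in>Q. e p (\<not> c2)) \<le> int (card Q) * (d - 1)"
    proof -
      have "e p (\<not> c2) \<le> d - 1" if "p \<in> Q" for p
        using normal[of p "\<not> c2"] notin that unfolding Q_def by fastforce
      then show ?thesis
        using sum_bounded_above[of Q "\<lambda>p. e p (\<not> c2)" "d - 1"] by simp
    qed
    moreover have "(\<Sum>p\<in>P. e p (\<not> c2)) = x"
      using e_sum unfolding x_def .
    moreover have "(\<Sum>p\<in>P. e p (\<not> c2)) = e p0 (\<not> c2) + (e p2 (\<not> c2) + (\<Sum>p\<in>Q. e p (\<not> c2)))"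
      unfolding Q(2) using Q by simp
    ultimately have "x \<le> r + (d + int (card Q) * (d - 1))"
      by linarith
    then have "2 * x \<le> x + 2 * d + (2 * int (card Q)) * (d - 1)"
      using \<open>2 * r = x\<close> by (simp add: algebra_simps)
    \<comment> \<open>The estimate becomes \<open>x \<le> d * d + 1\<close>, against
      \<open>x = d * d + d\<close>.\<close>
    also have "2 * int (card Q) = d - 1"
      using cardQ d by simp
    finally show False
      unfolding x using d5 by (simp add: algebra_simps)
  qed
  \<comment> \<open>\<open>R\<close> is unchanged when \<open>b\<close> and \<open>x - b\<close> are
    swapped, so \<open>apart\<close> applies to both.\<close>
  have R': "R = {r, x - b, x - (x - b)}" "r \<noteq> x - b"
    using R by auto
  obtain p1 c1 where p1: "p1 \<in> P" "e p1 c1 = b"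
    using R_E[of b] R by auto
  obtain p2 c2 where p2: "p2 \<in> P" "e p2 c2 = x - b"
    using R_E[of "x - b"] R by auto
  have other: "q = p \<Longrightarrow> c' = c \<or> e p (\<not> c) = e q c'" for p q c c'
    by (cases c; cases c') auto
  have ne1: "p0 \<noteq> p1"
    using apart[OF R(1,3)] other[of p1 p0 c1 c0] p0 p1 R(3) by auto
  have ne2: "p0 \<noteq> p2"
    using apart[OF R'] other[of p2 p0 c2 c0] p0 p2 R'(2) by auto
  have ne3: "p1 \<noteq> p2"
  proof
    assume "p1 = p2"
    moreover have "b \<noteq> x - b"
      using R(2,3) by auto
    ultimately have "e p1 (\<not> c1) = x - b"
      using other[of p2 p1 c2 c1] p1 p2 by auto
    then have "int (h p1) * d = 0"
      using e_add'[OF p1(1), of c1] p1 by simp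
    then show False
      using h_pos[OF p1(1)] d_pos by simp
  qed
  \<comment> \<open>At half-length \<open>d\<close> the ends would add up to \<open>d\<close>, but a
    label in \<open>R\<close> alone is larger.\<close>
  have exceptional: "h p \<noteq> nat d" if "p \<in> P" "e p c \<in> R" for p c
  proof
    assume "h p = nat d"
    then have "e p c + e p (\<not> c) = d"
      using e_add'[OF that(1), of c] x d_pos by simp
    then show False
      using R_gt[OF that(2)] e_bounds[OF that(1), of "\<not> c"] by simp
  qed
  have "{p \<in> P. h p = nat d} = P - {p0, p1, p2}"
  proof (intro equalityI subsetI)
    fix p assume "p \<in> {p \<in> P. h p = nat d}"
    then show "p \<in> P - {p0, p1, p2}"
      using exceptional[of p0 c0] exceptional[of p1 c1] exceptional[of p2 c2] p0 p1 p2 R(1) by auto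
  next
    fix p assume p: "p \<in> P - {p0, p1, p2}"
    have "e p c \<notin> R" for c
      using e_eq_iff[of p p0 c c0] e_eq_iff[of p p1 c c1] e_eq_iff[of p p2 c c2] p p0 p1 p2 R(1)
      by auto
    then show "p \<in> {p \<in> P. h p = nat d}"
      using normal p by blast
  qed
  moreover have "int (card (P - {p0, p1, p2})) = s - 3"
    using p0(1) p1(1) p2(1) ne1 ne2 ne3 finite_P s_eq s_ge by (simp add: card_Diff_subset)
  ultimately have "even (s - 3)"
    using parity[of "nat d"] by (metis even_of_nat)
  then show False
    using even_s by simp
qed

lemma families:
  "(\<exists>t\<ge>1. image_mset h (mset_set P) =
      replicate_mset (3 * t + 2) (2 * t) + replicate_mset t (2 * t + 1)) \<or>
   (\<exists>t\<ge>2. image_mset h (mset_set P) = {#t - 1, t - 1#} +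
      replicate_mset (t - 1) (2 * t - 2) + replicate_mset (t - 1) (2 * t - 1))"
proof -
  consider "card R = 0" | "card R = 2"
    using card_R_le card_R_1 card_R_3 by linarith
  then show ?thesis
    using card_R_0 card_R_2 by cases blast+
qed

end

section \<open>Bridge graphs\<close>

definition edge :: "'a list \<Rightarrow> nat \<Rightarrow> 'a set" where
  "edge p i = {p ! i, p ! Suc i}"

text \<open>Every path is a list read from \<open>u\<close> to \<open>v\<close>, so a path and a
  position together address an edge. By \<open>long\<close> the first and the last edge of a path
  differ.\<close>

locale bridge =
  fixes u v :: 'a and P :: "'a list set" and V :: "'a set" and E :: "'a set set"
  assumes uv: "u \<noteq> v" and finite_P: "finite P" and P_nonempty: "P \<noteq> {}"
    and paths: "p \<in> P \<Longrightarrow> path_between u v p"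
    and disjoint: "p \<in> P \<Longrightarrow> q \<in> P \<Longrightarrow> p \<noteq> q \<Longrightarrow> set p \<inter> set q = {u, v}"
    and long: "p \<in> P \<Longrightarrow> path_length p \<ge> 2"
    and V_eq: "V = {u, v} \<union> (\<Union>p\<in>P. set p)"
    and E_eq: "E = (\<Union>p\<in>P. path_edges p)"
begin

abbreviation "L \<equiv> path_length"

lemma length_eq: "p \<in> P \<Longrightarrow> length p = Suc (L p)"
  using long[of p] by (simp add: path_length_def)

lemma nth_0: "p \<in> P \<Longrightarrow> p ! 0 = u"
  using paths[of p] by (auto simp: path_between_def hd_conv_nth)

lemma nth_last: "p \<in> P \<Longrightarrow> p ! L p = v"
  using paths[of p] by (auto simp: path_between_def last_conv_nth path_length_def)

lemma nth_same: "p \<in> P \<Longrightarrow> i \<le> L p \<Longrightarrow> j \<le> L p \<Longrightarrow> p ! i = p ! j \<longleftrightarrow> i = j"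
  using paths[of p] by (simp add: path_between_def nth_eq_iff_index_eq length_eq)

lemma nth_eq_u: "p \<in> P \<Longrightarrow> i \<le> L p \<Longrightarrow> p ! i = u \<longleftrightarrow> i = 0"
  using nth_same[of p i 0] nth_0[of p] by simp

lemma nth_eq_v: "p \<in> P \<Longrightarrow> i \<le> L p \<Longrightarrow> p ! i = v \<longleftrightarrow> i = L p"
  using nth_same[of p i "L p"] nth_last[of p] by simp

lemma nth_eq_iff:
  assumes "p \<in> P" "q \<in> P" "i \<le> L p" "j \<le> L q"
  shows "p ! i = q ! j \<longleftrightarrow> (p = q \<and> i = j) \<or> (i = 0 \<and> j = 0) \<or> (i = L p \<and> j = L q)"
proof (cases "p = q")
  case True
  then show ?thesis
    using nth_same[of p i j] assms by auto
next
  case False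
  have "p ! i \<in> set p" "q ! j \<in> set q"
    using assms by (simp_all add: length_eq)
  then have "p ! i = q ! j \<Longrightarrow> p ! i = u \<or> p ! i = v"
    using disjoint[OF assms(1,2) False] by auto
  then show ?thesis
    using assms False nth_eq_u nth_eq_v nth_0 nth_last by metis
qed

text \<open>As every path has length at least 2, each edge has an inner vertex, which lies on one
  path only.\<close>

lemma edge_inj: "inj_on (\<lambda>(p, i). edge p i) (SIGMA p:P. {..<L p})"
proof (rule inj_onI, clarsimp)
  fix p i q j
  assume *: "p \<in> P" "i < L p" "q \<in> P" "j < L q" "edge p i = edge q j"
  then have "p ! i = q ! j \<and> p ! Suc i = q ! Suc j \<or> p ! i = q ! Suc j \<and> p ! Suc i = q ! j"
    by (auto simp: edge_def doubleton_eq_iff)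
  then show "p = q \<and> i = j"
    using * long[of p] long[of q]
      nth_eq_iff[of p q i j] nth_eq_iff[of p q "Suc i" "Suc j"]
      nth_eq_iff[of p q i "Suc j"] nth_eq_iff[of p q "Suc i" j]
    by auto
qed

lemma edge_image: "(\<lambda>(p, i). edge p i) ` (SIGMA p:P. {..<L p}) = E"
proof -
  have "path_edges p = edge p ` {..<L p}" if "p \<in> P" for p
    using that by (auto simp: path_edges_def edge_def length_eq)
  then have "E = (\<Union>p\<in>P. edge p ` {..<L p})"
    unfolding E_eq by simp
  then show ?thesis
    by (auto simp: image_iff Bex_def)
qed

lemma edge_bij: "bij_betw (\<lambda>(p, i). edge p i) (SIGMA p:P. {..<L p}) E"
  using edge_inj edge_image by (simp add: bij_betw_def)

lemma card_E: "card E = sum L P"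
  using bij_betw_same_card[OF edge_bij] finite_P by simp

lemma vertex_sum_positions:
  "vertex_sum E f z = (\<Sum>(p, i)\<in>{(p, i). p \<in> P \<and> i < L p \<and> z \<in> edge p i}. f (edge p i))"
proof -
  have *: "{e \<in> E. z \<in> e} = (\<lambda>(p, i). edge p i) ` {(p, i). p \<in> P \<and> i < L p \<and> z \<in> edge p i}"
    unfolding edge_image[symmetric] by auto
  have "inj_on (\<lambda>(p, i). edge p i) {(p, i). p \<in> P \<and> i < L p \<and> z \<in> edge p i}"
    by (rule inj_on_subset[OF edge_inj]) auto
  then show ?thesis
    unfolding vertex_sum_def * by (simp add: sum.reindex case_prod_beta')
qed

lemma vertex_sum_u: "vertex_sum E f u = (\<Sum>p\<in>P. f (edge p 0))"
proof -
  have "{(p, i). p \<in> P \<and> i < L p \<and> u \<in> edge p i} = (\<lambda>p. (p, 0)) ` P"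
  proof -
    have "u \<in> edge p i \<longleftrightarrow> i = 0" if "p \<in> P" "i < L p" for p i
      using nth_eq_u[of p i] nth_eq_u[of p "Suc i"] that by (auto simp: edge_def)
    then show ?thesis
      using long by fastforce
  qed
  moreover have "inj_on (\<lambda>p. (p, 0 :: nat)) P"
    by (rule inj_onI) simp
  ultimately show ?thesis
    unfolding vertex_sum_positions by (simp add: sum.reindex)
qed

lemma vertex_sum_v: "vertex_sum E f v = (\<Sum>p\<in>P. f (edge p (L p - 1)))"
proof -
  have "{(p, i). p \<in> P \<and> i < L p \<and> v \<in> edge p i} = (\<lambda>p. (p, L p - 1)) ` P"
  proof -
    have "v \<in> edge p i \<longleftrightarrow> i = L p - 1" if "p \<in> P" "i < L p" for p i
      using nth_eq_v[of p i] nth_eq_v[of p "Suc i"] that by (auto simp: edge_def)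
    then show ?thesis
      using long by fastforce
  qed
  moreover have "inj_on (\<lambda>p. (p, L p - 1)) P"
    by (rule inj_onI) simp
  ultimately show ?thesis
    unfolding vertex_sum_positions by (simp add: sum.reindex)
qed

lemma vertex_sum_inner:
  assumes "q \<in> P" "Suc j < L q"
  shows "vertex_sum E f (q ! Suc j) = f (edge q j) + f (edge q (Suc j))"
proof -
  have "q ! Suc j \<in> edge p i \<longleftrightarrow> p = q \<and> (i = j \<or> i = Suc j)" if "p \<in> P" "i < L p" for p i
    using nth_eq_iff[of q p "Suc j" i] nth_eq_iff[of q p "Suc j" "Suc i"] that assms
    by (auto simp: edge_def)
  then have "{(p, i). p \<in> P \<and> i < L p \<and> q ! Suc j \<in> edge p i} = {(q, j), (q, Suc j)}"
    using assms by auto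
  then show ?thesis
    unfolding vertex_sum_positions by simp
qed

lemma V_cases:
  assumes "z \<in> V"
  obtains "z = u" | "z = v" | p i where "p \<in> P" "Suc i < L p" "z = p ! Suc i"
proof -
  consider "z = u" | "z = v" | p where "p \<in> P" "z \<in> set p" "z \<noteq> u" "z \<noteq> v"
    using assms unfolding V_eq by auto
  then show thesis
  proof cases
    case (3 p)
    then obtain i where i: "i \<le> L p" "z = p ! i"
      by (auto simp: in_set_conv_nth length_eq less_Suc_eq_le)
    moreover have "i \<noteq> 0" "i \<noteq> L p"
      using 3(3,4) i nth_0[OF 3(1)] nth_last[OF 3(1)] by metis+
    ultimately show thesis
      using 3 that(3)[of p "i - 1"] by auto
  qed (use that in auto)
qed

lemma nth_in_V: "p \<in> P \<Longrightarrow> i \<le> L p \<Longrightarrow> p ! i \<in> V"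
  unfolding V_eq by (rule UnI2, rule UN_I[of p]) (simp_all add: length_eq)

lemma u_in_V: "u \<in> V"
  unfolding V_eq by auto

lemma finite_V: "finite V"
  unfolding V_eq using finite_P by simp

lemma edge_E: "p \<in> P \<Longrightarrow> i < L p \<Longrightarrow> {p ! i, p ! Suc i} \<in> E"
  unfolding edge_image[symmetric] edge_def[symmetric]
  by (rule image_eqI[of _ _ "(p, i)"]) simp_all

lemma adjacent_E:
  assumes "{y, z} \<in> E"
  obtains p i where "p \<in> P" "i < L p" "y = p ! i \<and> z = p ! Suc i \<or> z = p ! i \<and> y = p ! Suc i"
proof -
  from assms obtain p i where "p \<in> P" "i < L p" "{y, z} = {p ! i, p ! Suc i}"
    unfolding edge_image[symmetric] edge_def by auto
  then show thesis
    using that[of p i] by (metis doubleton_eq_iff)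
qed

end

section \<open>Two colours: reduction to the end labels\<close>

lemma sum_lessThan_double:
  fixes g :: "nat \<Rightarrow> 'b :: comm_monoid_add"
  shows "(\<Sum>i<2 * n. g i) = (\<Sum>j<n. g (2 * j) + g (Suc (2 * j)))"
  by (induction n) (simp_all add: add.assoc)

context bridge
begin

context
  fixes f :: "'a set \<Rightarrow> nat"
  assumes f: "local_antimagic_labeling V E f" and two: "num_colors V E f \<le> 2"
begin

definition X :: int where "X = int (vertex_sum E f u)"
text \<open>The colour of the neighbour of \<open>u\<close> on an arbitrarily chosen path. By
  \<open>XY\<close> and \<open>colour\<close> it is the only colour besides
  \<open>X\<close>.\<close>

definition Y :: int where "Y = int (vertex_sum E f ((SOME p. p \<in> P) ! 1))"
definition F :: "'a list \<Rightarrow> nat \<Rightarrow> int" where "F p i = int (f (edge p i))"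

section \<open>The labels as integers and the alternation of the two colours\<close>

lemma F_bij: "bij_betw (\<lambda>(p, i). F p i) (SIGMA p:P. {..<L p}) {1..int (sum L P)}"
proof -
  have "bij_betw f E {1..sum L P}"
    using f card_E by (simp add: local_antimagic_labeling_def)
  then have "bij_betw (f \<circ> (\<lambda>(p, i). edge p i)) (SIGMA p:P. {..<L p}) {1..sum L P}"
    by (rule bij_betw_trans[OF edge_bij])
  moreover have "bij_betw int {1..sum L P} {1..int (sum L P)}"
    by (auto simp: bij_betw_def image_int_atLeastAtMost)
  ultimately have "bij_betw (int \<circ> (f \<circ> (\<lambda>(p, i). edge p i))) (SIGMA p:P. {..<L p}) {1..int (sum L P)}"
    by (rule bij_betw_trans)
  then show ?thesis
    by (rule bij_betw_cong[THEN iffD1, rotated]) (auto simp: F_def)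
qed

lemma F_eq_iff: "p \<in> P \<Longrightarrow> q \<in> P \<Longrightarrow> i < L p \<Longrightarrow> j < L q \<Longrightarrow> F p i = F q j \<longleftrightarrow> p = q \<and> i = j"
  using inj_onD[OF bij_betw_imp_inj_on[OF F_bij], of "(p, i)" "(q, j)"] by auto

lemma F_bounds: "p \<in> P \<Longrightarrow> i < L p \<Longrightarrow> 1 \<le> F p i \<and> F p i \<le> int (sum L P)"
  using bij_betw_apply[OF F_bij, of "(p, i)"] by auto

lemma F_E:
  assumes "1 \<le> a" "a \<le> int (sum L P)"
  obtains p i where "p \<in> P" "i < L p" "F p i = a"
proof -
  have "a \<in> (\<lambda>(p, i). F p i) ` (SIGMA p:P. {..<L p})"
    using F_bij assms by (simp add: bij_betw_def)
  then show thesis using that by auto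
qed

lemma F_total: "2 * (\<Sum>p\<in>P. \<Sum>i<L p. F p i) = int (sum L P) * (int (sum L P) + 1)"
proof -
  have "(\<Sum>p\<in>P. \<Sum>i<L p. F p i) = (\<Sum>(p, i)\<in>(SIGMA p:P. {..<L p}). F p i)"
    using finite_P by (simp add: sum.Sigma)
  also have "\<dots> = \<Sum>{1..int (sum L P)}"
    using sum.reindex_bij_betw[OF F_bij, of "\<lambda>a. a"] by (simp add: case_prod_beta')
  also have "{1..int (sum L P)} = int ` {1..sum L P}"
    by (simp add: image_int_atLeastAtMost)
  also have "\<Sum>\<dots> = (\<Sum>i=1..sum L P. int i)"
    by (simp add: sum.reindex)
  also have "2 * \<dots> = int (sum L P) * (int (sum L P) + 1)"
    using double_gauss_sum_from_Suc_0[of "sum L P", where 'a=int] by simp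
  finally show ?thesis .
qed

lemma XY: "X \<noteq> Y" and colour: "z \<in> V \<Longrightarrow> int (vertex_sum E f z) = X \<or> int (vertex_sum E f z) = Y"
proof -
  define z1 where "z1 = (SOME p. p \<in> P) ! 1"
  have P0: "(SOME p. p \<in> P) \<in> P"
    using P_nonempty some_in_eq by blast
  then have "{u, z1} \<in> E" and z1: "z1 \<in> V"
    using edge_E[OF P0, of 0] nth_0[OF P0] long[OF P0] nth_in_V[OF P0, of 1] by (auto simp: z1_def)
  then have ne: "vertex_sum E f u \<noteq> vertex_sum E f z1"
    using f u_in_V by (auto simp: local_antimagic_labeling_def)
  then show "X \<noteq> Y"
    by (simp add: X_def Y_def z1_def)
  have "{vertex_sum E f u, vertex_sum E f z1} = vertex_sum E f ` V"
    by (rule card_seteq) (use finite_V u_in_V z1 two ne in \<open>auto simp: num_colors_def\<close>)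
  then show "z \<in> V \<Longrightarrow> int (vertex_sum E f z) = X \<or> int (vertex_sum E f z) = Y"
    by (auto simp: X_def Y_def z1_def)
qed

lemma colour_nth:
  "p \<in> P \<Longrightarrow> i \<le> L p \<Longrightarrow> int (vertex_sum E f (p ! i)) = (if even i then X else Y)"
proof (induction i)
  case 0
  then show ?case by (simp add: nth_0 X_def)
next
  case (Suc i)
  have "vertex_sum E f (p ! i) \<noteq> vertex_sum E f (p ! Suc i)"
    using f edge_E[of p i] nth_in_V[of p i] nth_in_V[of p "Suc i"] Suc
    by (auto simp: local_antimagic_labeling_def)
  then show ?case
    using Suc colour[OF nth_in_V[of p "Suc i"]] by (auto split: if_splits)
qed

lemma F_pair: "p \<in> P \<Longrightarrow> Suc i < L p \<Longrightarrow> F p i + F p (Suc i) = (if even i then Y else X)"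
  using colour_nth[of p "Suc i"] vertex_sum_inner[of p i f] by (auto simp: F_def)

lemma F_start: "(\<Sum>p\<in>P. F p 0) = X"
  by (simp add: F_def X_def vertex_sum_u)

lemma F_end: "(\<Sum>p\<in>P. F p (L p - 1)) = int (vertex_sum E f v)"
  by (simp add: F_def vertex_sum_v)

text \<open>The edges are grouped by the vertices at odd positions, all of colour
  \<open>Y\<close>.\<close>

lemma sum_pairs_even:
  assumes "p \<in> P" "2 * k \<le> L p"
  shows "(\<Sum>i<2 * k. F p i) = int k * Y"
proof -
  have "(\<Sum>j<k. F p (2 * j) + F p (Suc (2 * j))) = (\<Sum>j<k. Y)"
    by (rule sum.cong) (use assms F_pair in auto)
  then show ?thesis
    by (simp add: sum_lessThan_double)
qed

text \<open>The edges after the first are grouped by inner vertices at even positions, all of colour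
  \<open>X\<close>.\<close>

lemma sum_pairs_odd:
  assumes "p \<in> P" "2 * k < L p"
  shows "(\<Sum>i<Suc (2 * k). F p i) = F p 0 + int k * X"
proof -
  have "(\<Sum>j<k. F p (Suc (2 * j)) + F p (Suc (Suc (2 * j)))) = (\<Sum>j<k. X)"
    by (rule sum.cong) (use assms F_pair in auto)
  then have "(\<Sum>i<2 * k. F p (Suc i)) = int k * X"
    by (simp add: sum_lessThan_double)
  then show ?thesis
    by (simp only: sum.lessThan_Suc_shift)
qed

text \<open>If \<open>u\<close> and \<open>v\<close> get different colours, both colour classes cover every edge and have the
  same size, so the two colours agree.\<close>

lemma even_L: "p \<in> P \<Longrightarrow> even (L p)"
proof (rule ccontr)
  assume "p \<in> P" "odd (L p)"
  then have v: "int (vertex_sum E f v) = Y"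
    using colour_nth[of p "L p"] nth_last by simp
  have odd: "odd (L q)" if "q \<in> P" for q
    using colour_nth[of q "L q"] nth_last[OF that] that v XY by (auto split: if_splits)
  define h where "h q = L q div 2" for q :: "'a list"
  have L: "L q = Suc (2 * h q)" if "q \<in> P" for q
    using odd[OF that] unfolding h_def by simp
  \<comment> \<open>Both sides are the sum of all labels on \<open>q\<close>, in the two
    groupings.\<close>
  have "F q 0 + int (h q) * X = int (h q) * Y + F q (L q - 1)" if "q \<in> P" for q
    using sum_pairs_odd[OF that, of "h q"] sum_pairs_even[OF that, of "h q"] L[OF that] by simp
  then have "(\<Sum>q\<in>P. F q 0 + int (h q) * X) = (\<Sum>q\<in>P. int (h q) * Y + F q (L q - 1))"
    by (rule sum.cong[OF refl])
  then have "X + (\<Sum>q\<in>P. int (h q)) * X = (\<Sum>q\<in>P. int (h q)) * Y + Y"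
    unfolding sum.distrib F_start F_end v by (simp only: sum_distrib_right)
  then have "(1 + (\<Sum>q\<in>P. int (h q))) * (X - Y) = 0"
    by (simp add: algebra_simps)
  moreover have "(\<Sum>q\<in>P. int (h q)) \<ge> 0"
    by (simp add: sum_nonneg)
  ultimately show False
    using XY by simp
qed

definition h :: "'a list \<Rightarrow> nat" where "h p = L p div 2"

lemma L_h: "p \<in> P \<Longrightarrow> L p = 2 * h p"
  using even_L by (simp add: h_def)

lemma h_ge: "p \<in> P \<Longrightarrow> h p \<ge> 1"
  using long[of p] L_h[of p] by simp

definition N :: int where "N = int (sum h P)"

lemma sum_L: "int (sum L P) = 2 * N"
  unfolding N_def using L_h by (simp add: sum_distrib_left)

lemma N_ge: "N \<ge> int (card P)" "int (card P) \<ge> 1"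
proof -
  have "card P * 1 \<le> sum h P"
    using sum_bounded_below[of P 1 h] h_ge by simp
  then show "N \<ge> int (card P)"
    unfolding N_def by (simp only: of_nat_le_iff mult_1_right)
  show "int (card P) \<ge> 1"
    using P_nonempty finite_P by (simp add: Suc_le_eq card_gt_0_iff)
qed

text \<open>Each edge has exactly one end of colour \<open>Y\<close>, and there are \<open>N\<close>
  such vertices, so \<open>N * Y\<close> is the sum of all labels.\<close>

lemma Y_eq: "Y = 2 * N + 1"
proof -
  have "(\<Sum>p\<in>P. \<Sum>i<L p. F p i) = (\<Sum>p\<in>P. int (h p) * Y)"
    by (rule sum.cong) (use sum_pairs_even L_h in auto)
  also have "\<dots> = N * Y"
    by (simp add: sum_distrib_right N_def)
  finally have "(2 * N) * (2 * N + 1) = (2 * N) * Y"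
    using F_total unfolding sum_L by auto
  then show ?thesis
    using N_ge by simp
qed

lemma v_colour: "int (vertex_sum E f v) = X"
proof -
  obtain p where "p \<in> P"
    using P_nonempty by blast
  then show ?thesis
    using colour_nth[of p "L p"] nth_last even_L by simp
qed

text \<open>The same count for the colour \<open>X\<close>, whose vertices are \<open>u\<close>,
  \<open>v\<close> and \<open>h p - 1\<close> inner vertices of each path \<open>p\<close>.\<close>

lemma X_eq: "(N - int (card P) + 2) * X = N * Y"
proof -
  have "F p 0 + int (h p - 1) * X + F p (L p - 1) = int (h p) * Y" if "p \<in> P" for p
  proof -
    obtain k where k: "h p = Suc k"
      using h_ge[OF \<open>p \<in> P\<close>] by (cases "h p") auto
    show ?thesis
      using sum_pairs_odd[OF that, of k] sum_pairs_even[OF that, of "h p"] L_h[OF that] k by simp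
  qed
  then have "(\<Sum>p\<in>P. F p 0 + int (h p - 1) * X + F p (L p - 1)) = (\<Sum>p\<in>P. int (h p) * Y)"
    by (rule sum.cong[OF refl])
  then have *: "2 * X + (\<Sum>p\<in>P. int (h p - 1)) * X = N * Y"
    unfolding sum.distrib F_start F_end v_colour by (simp add: sum_distrib_right N_def)
  have "(\<Sum>p\<in>P. int (h p - 1)) = N - int (card P)"
    unfolding N_def using h_ge by (simp add: of_nat_diff sum_subtractf)
  from *[unfolded this] show ?thesis
    by (simp add: algebra_simps)
qed

text \<open>Two steps along a path pass a vertex of colour \<open>Y\<close> and then one of colour
  \<open>X\<close>.\<close>

lemma F_progression:
  "p \<in> P \<Longrightarrow> j < h p \<Longrightarrow> F p (2 * j) = F p 0 + int j * (X - Y)"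
proof (induction j)
  case (Suc j)
  then show ?case
    using F_pair[of p "2 * j"] F_pair[of p "Suc (2 * j)"] L_h[of p] by (simp add: algebra_simps)
qed simp

text \<open>Between the first and the last edge of a path of even length, the edges are paired at
  the inner vertices of colour \<open>X\<close>: 1 with 2, 3 with 4, and so on.\<close>

lemma inner_partner:
  assumes "p \<in> P" "0 < i" "i < L p - 1"
  obtains j where "0 < j" "j < L p - 1" "F p i + F p j = X"
proof (cases "even i")
  case True
  then obtain k where "i = 2 * k"
    by (rule evenE)
  then have "0 < i - 1" "i - 1 < L p - 1" "F p i + F p (i - 1) = X"
    using assms F_pair[of p "i - 1"] True by (auto simp: add.commute)
  then show thesis using that by blast
next
  case False
  then have "Suc i < L p - 1"
    using assms even_L[OF assms(1)] by presburger
  moreover from this have "F p i + F p (Suc i) = X"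
    using assms(1) F_pair[of p i] False by simp
  ultimately show thesis using that by blast
qed

text \<open>The first alternative is \<open>K_{2,s}\<close>; the other two are the outcomes of
  \<open>families\<close>, doubled.\<close>

lemma two_colour_lengths:
  assumes parity: "\<And>n. even (card {p \<in> P. L p = n})"
  shows "(card P \<ge> 4 \<and> (\<forall>p\<in>P. L p = 2)) \<or>
    (\<exists>t\<ge>1. image_mset L (mset_set P) =
      replicate_mset (3 * t + 2) (4 * t) + replicate_mset t (4 * t + 2)) \<or>
    (\<exists>t\<ge>2. image_mset L (mset_set P) = {#2 * t - 2, 2 * t - 2#} +
      replicate_mset (t - 1) (4 * t - 4) + replicate_mset (t - 1) (4 * t - 2))"
proof -
  have "even (card P)"
    by (rule even_card_of_fibres[OF finite_P parity])
  \<comment> \<open>With two paths \<open>X_eq\<close> reads \<open>N * X = N * Y\<close>.\<close>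
  moreover have "card P \<noteq> 2"
    using X_eq XY N_ge by auto
  ultimately have card: "card P \<ge> 4"
    using N_ge(2) by (auto elim!: evenE)
  define d where "d = X - Y"
  \<comment> \<open>For at least four paths the factor of \<open>X\<close> in \<open>X_eq\<close> is
    smaller than \<open>N\<close>, so \<open>X\<close> must exceed \<open>Y\<close>.\<close>
  have d_pos: "d > 0"
  proof (rule ccontr)
    assume "\<not> d > 0"
    then have "(N - int (card P) + 2) * X \<le> (N - int (card P) + 2) * Y"
      using N_ge by (simp add: d_def mult_left_mono)
    also have "\<dots> < N * Y"
      using N_ge Y_eq card by (simp add: mult_less_cancel_right_pos)
    finally show False
      using X_eq by simp
  qed
  show ?thesis
  proof (cases "\<forall>p\<in>P. L p = 2")
    case True
    then show ?thesis
      using card by simp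
  next
    case False
    then obtain p0 where p0: "p0 \<in> P" "L p0 \<ge> 4"
      using L_h h_ge by (metis One_nat_def Suc_1 Suc_leI le_neq_implies_less mult.right_neutral
          mult_2 numeral_Bit0 add_mono)
    \<comment> \<open>A path of length at least 4 has an inner vertex of colour \<open>X\<close>;
      its two labels bound \<open>X\<close> by \<open>4 * N\<close>, so all of \<open>1..d\<close>
      are labels.\<close>
    have d_le: "d \<le> 2 * N"
    proof -
      have "F p0 1 + F p0 2 = X"
        using F_pair[OF p0(1), of 1] p0(2) by (simp add: numeral_2_eq_2)
      then show ?thesis
        using F_bounds[OF p0(1), of 1] F_bounds[OF p0(1), of 2] p0 Y_eq sum_L d_def by auto
    qed
    define e where "e p c = (if c then F p 0 else F p (L p - 1))" for p c
    interpret end_labels P h e d N "int (card P)"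
    proof
      show "finite P" "int (card P) = int (card P)" "N = int (sum h P)" "d > 0"
        using finite_P d_pos N_def by auto
      show "int (card P) \<ge> 4"
        using card by simp
      show "h p \<ge> 1" if "p \<in> P" for p
        using h_ge[OF that] .
      show "inj_on (\<lambda>(p, c). e p c) (P \<times> UNIV)"
      proof (rule inj_onI, clarsimp)
        fix p c q c'
        assume *: "p \<in> P" "q \<in> P" "e p c = e q c'"
        have "(0::nat) < L p" "0 < L q" "L p - 1 \<noteq> 0" "L q - 1 \<noteq> 0"
          using long[of p] long[of q] * by auto
        then show "p = q \<and> c = c'"
          using * F_eq_iff[of p q] by (auto simp: e_def split: if_splits)
      qed
      show "1 \<le> e p c \<and> e p c \<le> 2 * N" if "p \<in> P" for p c
        using F_bounds[OF that, of 0] F_bounds[OF that, of "L p - 1"] long[OF that] sum_L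
        by (auto simp: e_def)
      \<comment> \<open>The last edge has position \<open>2 * k + 1\<close> and shares a vertex of
        colour \<open>Y\<close> with edge \<open>2 * k\<close>, whose label the progression
        gives.\<close>
      show "e p True + e p False = 2 * N + 1 - (int (h p) - 1) * d" if "p \<in> P" for p
      proof -
        obtain k where k: "h p = Suc k"
          using h_ge[OF \<open>p \<in> P\<close>] by (cases "h p") auto
        then show ?thesis
          using F_progression[OF that, of k] F_pair[OF that, of "2 * k"] L_h[OF that] Y_eq
          by (simp add: e_def d_def)
      qed
      show "(\<Sum>p\<in>P. e p c) = 2 * N + 1 + d" for c
        using F_start F_end v_colour Y_eq by (cases c) (simp_all add: e_def d_def)
      \<comment> \<open>An inner label \<open>a \<le> d\<close> would have the partner
        \<open>X - a \<ge> 2 * N + 1\<close>, larger than every label.\<close>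
      show "\<exists>p\<in>P. \<exists>c. e p c = a" if a: "1 \<le> a" "a \<le> d" for a
      proof -
        obtain p i where p: "p \<in> P" "i < L p" "F p i = a"
          by (rule F_E[of a]) (use a d_le sum_L in auto)
        have "\<not> (0 < i \<and> i < L p - 1)"
        proof
          assume "0 < i \<and> i < L p - 1"
          then obtain j where "j < L p - 1" "F p i + F p j = X"
            using inner_partner[OF p(1)] by blast
          moreover from this have "j < L p" by simp
          ultimately show False
            using F_bounds[OF p(1), of j] p a sum_L Y_eq d_def by simp
        qed
        then have "i = 0 \<or> i = L p - 1"
          using p(2) by linarith
        then have "e p (i = 0) = a"
          using p(3) by (auto simp: e_def)
        then show ?thesis
          using p(1) by blast
      qed
      \<comment> \<open>The number \<open>X - e p c\<close> is a label; on an inner edge, its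
        partner would be the end label \<open>e p c\<close> itself.\<close>
      show "\<exists>q\<in>P. \<exists>c'. e q c' = 2 * N + 1 + d - e p c" if pc: "p \<in> P" "e p c > d" for p c
      proof -
        define k where "k = (if c then 0 else L p - 1)"
        have k: "k < L p" "e p c = F p k" "\<not> (0 < k \<and> k < L p - 1)"
          using long[OF pc(1)] by (auto simp: k_def e_def)
        obtain q i where q: "q \<in> P" "i < L q" "F q i = X - e p c"
          by (rule F_E[of "X - e p c"])
            (use F_bounds[OF pc(1) k(1)] pc(2) k(2) sum_L Y_eq d_def d_pos in auto)
        have "\<not> (0 < i \<and> i < L q - 1)"
        proof
          assume "0 < i \<and> i < L q - 1"
          then obtain j where j: "0 < j" "j < L q - 1" "F q i + F q j = X"
            using inner_partner[OF q(1)] by blast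
          then have "F q j = F p k"
            using q k by simp
          then have "q = p \<and> j = k"
            using F_eq_iff[OF q(1) pc(1), of j k] j k by simp
          then show False
            using j k by simp
        qed
        then have "i = 0 \<or> i = L q - 1"
          using q(2) by linarith
        then have "e q (i = 0) = X - e p c"
          using q(3) by (auto simp: e_def)
        then show ?thesis
          using q(1) Y_eq d_def by (metis add_diff_cancel_left' diff_add_cancel add.commute)
      qed
      show "even (card {p \<in> P. h p = n})" for n
      proof -
        have "{p \<in> P. h p = n} = {p \<in> P. L p = 2 * n}"
          using L_h by auto
        then show ?thesis
          using parity by simp
      qed
    qed
    have "image_mset L (mset_set P) = image_mset ((*) 2) (image_mset h (mset_set P))"
      using L_h finite_P by (auto simp: multiset.map_comp intro!: image_mset_cong)
    then show ?thesis
      using families by (auto simp: right_diff_distrib')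
  qed
qed

end

end

section \<open>A labeling with three colours\<close>

lemma image_mset_eq_imp_bij_betw:
  assumes "finite A" "finite B" "image_mset f (mset_set A) = image_mset g (mset_set B)"
  shows "\<exists>h. bij_betw h A B \<and> (\<forall>a\<in>A. g (h a) = f a)"
  using assms
proof (induction A arbitrary: B rule: finite_induct)
  case empty
  then have "B = {}"
    by (simp add: mset_set_empty_iff)
  then show ?case by (simp add: bij_betw_def)
next
  case (insert a A)
  have "f a \<in># image_mset g (mset_set B)"
    unfolding insert.prems(2)[symmetric] using insert.hyps by simp
  then obtain b where b: "b \<in> B" "g b = f a"
    using insert.prems(1) by auto
  define B' where "B' = B - {b}"
  have B': "B = insert b B'" "b \<notin> B'" "finite B'"
    using b insert.prems(1) by (auto simp: B'_def)
  have "image_mset f (mset_set A) = image_mset g (mset_set B')"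
    using insert.prems(2) insert.hyps B' b by simp
  then obtain h where h: "bij_betw h A B'" "\<forall>a\<in>A. g (h a) = f a"
    using insert.IH[OF B'(3)] by blast
  have "bij_betw (h(a := b)) A B'"
    using h(1) insert.hyps(2) by (subst bij_betw_cong[of A _ h]) auto
  then have "bij_betw (h(a := b)) (A \<union> {a}) (B' \<union> {b})"
    by (rule bij_betw_combine) (use B' in auto)
  then have "bij_betw (h(a := b)) (insert a A) B"
    using B'(1) by simp
  moreover have "\<forall>x\<in>insert a A. g ((h(a := b)) x) = f x"
    using h(2) b(2) by auto
  ultimately show ?case by blast
qed

lemma sum_replicate_mset_two:
  fixes l :: nat
  shows "(\<Sum>i=1..l. replicate_mset 2 (m i)) = image_mset (m \<circ> fst) (mset_set ({1..l} \<times> (UNIV :: bool set)))"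
proof (induction l)
  case (Suc l)
  have "{1..Suc l} \<times> (UNIV :: bool set) = insert (Suc l, True) (insert (Suc l, False) ({1..l} \<times> UNIV))"
    by (auto simp: UNIV_bool atLeastAtMostSuc_conv)
  then show ?case
    using Suc by (simp add: numeral_2_eq_2)
qed simp

context bridge
begin

context
  fixes l :: nat and m :: "nat \<Rightarrow> nat"
  assumes lengths: "image_mset L (mset_set P) = (\<Sum>i=1..l. replicate_mset 2 (m i))"
begin

text \<open>The Boolean tells the two paths of an index apart; below, \<open>True\<close> receives
  even labels and \<open>False\<close> odd ones.\<close>

definition pairing :: "'a list \<Rightarrow> nat \<times> bool" where
  "pairing = (SOME g. bij_betw g P ({1..l} \<times> UNIV) \<and> (\<forall>p\<in>P. m (fst (g p)) = L p))"

lemma pairing_bij: "bij_betw pairing P ({1..l} \<times> UNIV)"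
  and m_pairing: "p \<in> P \<Longrightarrow> m (fst (pairing p)) = L p"
proof -
  have "image_mset L (mset_set P) = image_mset (m \<circ> fst) (mset_set ({1..l} \<times> (UNIV :: bool set)))"
    unfolding lengths by (rule sum_replicate_mset_two)
  then have "\<exists>g. bij_betw g P ({1..l} \<times> (UNIV :: bool set)) \<and> (\<forall>p\<in>P. (m \<circ> fst) (g p) = L p)"
    by (intro image_mset_eq_imp_bij_betw[where f=L and g="m \<circ> fst" and A=P
          and B="{1..l} \<times> UNIV"]) (simp_all only: finite_P finite_atLeastAtMost
          finite finite_cartesian_product)
  then have "bij_betw pairing P ({1..l} \<times> UNIV) \<and> (\<forall>p\<in>P. m (fst (pairing p)) = L p)"
    unfolding pairing_def comp_def by (rule someI_ex)
  then show "bij_betw pairing P ({1..l} \<times> UNIV)" "p \<in> P \<Longrightarrow> m (fst (pairing p)) = L p"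
    by auto
qed

lemma sum_pairing:
  fixes \<phi> :: "nat \<times> bool \<Rightarrow> nat"
  shows "(\<Sum>p\<in>P. \<phi> (pairing p)) = (\<Sum>i=1..l. \<phi> (i, True) + \<phi> (i, False))"
proof -
  have "(\<Sum>p\<in>P. \<phi> (pairing p)) = (\<Sum>x\<in>{1..l} \<times> UNIV. \<phi> x)"
    by (rule sum.reindex_bij_betw[OF pairing_bij])
  also have "\<dots> = (\<Sum>i=1..l. \<Sum>c\<in>UNIV. \<phi> (i, c))"
    by (simp add: sum.cartesian_product)
  finally show ?thesis
    by (simp add: UNIV_bool add.commute)
qed

section \<open>The label sequence and its segments\<close>

definition M :: nat where "M = (\<Sum>i=1..l. m i)"

definition offset :: "nat \<Rightarrow> nat" where "offset i = (\<Sum>j=1..<i. m j)"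

lemma offset_add: "i < j \<Longrightarrow> 1 \<le> i \<Longrightarrow> offset i + m i \<le> offset j"
proof -
  assume ij: "i < j" "1 \<le> i"
  then have "offset i + m i = (\<Sum>j=1..<Suc i. m j)"
    by (simp add: offset_def)
  also have "\<dots> \<le> offset j"
    unfolding offset_def using ij by (intro sum_mono2) auto
  finally show ?thesis .
qed

lemma offset_le: "1 \<le> i \<Longrightarrow> i \<le> l \<Longrightarrow> offset i + m i \<le> M"
  using offset_add[of i "Suc l"] by (simp add: offset_def M_def atLeastLessThanSuc_atLeastAtMost)

lemma card_E_M: "card E = 2 * M"
proof -
  have "sum L P = (\<Sum>p\<in>P. (m \<circ> fst) (pairing p))"
    using m_pairing by simp
  also have "\<dots> = 2 * M"
    unfolding sum_pairing M_def by (simp add: sum_distrib_left mult_2)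
  finally show ?thesis
    by (simp add: card_E)
qed

text \<open>The sequence \<open>2 * M, 2, 2 * M - 2, 4, ...\<close>, counted from 0 and used for
  \<open>k < M\<close>.\<close>

definition evens :: "nat \<Rightarrow> nat" where
  "evens k = (if even k then 2 * M - k else k + 1)"

definition label :: "nat \<times> bool \<Rightarrow> nat \<Rightarrow> nat" where
  "label x k = (let a = evens (offset (fst x) + k) in if snd x then a else 2 * M + 1 - a)"

lemma evens_bounds: "k < M \<Longrightarrow> 1 \<le> evens k \<and> evens k \<le> 2 * M" "k < M \<Longrightarrow> even (evens k)"
  by (auto simp: evens_def)

text \<open>Equal values at positions of different parity would give
  \<open>k + k' + 1 = 2 * M\<close>, too large for \<open>k, k' < M\<close>.\<close>

lemma evens_inj: "k < M \<Longrightarrow> k' < M \<Longrightarrow> evens k = evens k' \<Longrightarrow> k = k'"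
  by (auto simp: evens_def split: if_splits)

lemma evens_add: "Suc k < M \<Longrightarrow> evens k + evens (Suc k) = (if even k then 2 * M + 2 else 2 * M)"
  by (auto simp: evens_def)

lemma position_less:
  assumes "i \<in> {1..l}" "k < m i"
  shows "offset i + k < M"
  using offset_le[of i] assms by auto

lemma position_inj:
  assumes "i \<in> {1..l}" "k < m i" "j \<in> {1..l}" "k' < m j" "offset i + k = offset j + k'"
  shows "i = j \<and> k = k'"
  using offset_add[of i j] offset_add[of j i] assms by (cases i j rule: linorder_cases) auto

lemma label_bounds: "fst x \<in> {1..l} \<Longrightarrow> k < m (fst x) \<Longrightarrow> 1 \<le> label x k \<and> label x k \<le> 2 * M"
  using evens_bounds[OF position_less] by (fastforce simp: label_def Let_def)

text \<open>The parity of a label reveals the Boolean, its value the place in the sequence, and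
  disjointness of the segments the index.\<close>

lemma label_inj:
  assumes "fst x \<in> {1..l}" "k < m (fst x)" "fst y \<in> {1..l}" "k' < m (fst y)" "label x k = label y k'"
  shows "x = y \<and> k = k'"
proof -
  let ?a = "evens (offset (fst x) + k)" and ?b = "evens (offset (fst y) + k')"
  note a = evens_bounds[OF position_less[OF assms(1,2)]]
  note b = evens_bounds[OF position_less[OF assms(3,4)]]
  have "even (label x k) \<longleftrightarrow> snd x" "even (label y k') \<longleftrightarrow> snd y"
    using a b by (auto simp: label_def Let_def)
  then have snd: "snd x = snd y"
    using assms(5) by simp
  then have "?a = ?b"
    using assms(5) a b by (auto simp: label_def Let_def split: if_splits)
  then have "offset (fst x) + k = offset (fst y) + k'"
    using evens_inj[OF position_less[OF assms(1,2)] position_less[OF assms(3,4)]] by simp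
  then show ?thesis
    using position_inj[OF assms(1-4)] snd by (auto simp: prod_eq_iff)
qed

text \<open>Complementing turns a sum \<open>c\<close> into \<open>4 * M + 2 - c\<close> and so
  exchanges \<open>2 * M + 2\<close> and \<open>2 * M\<close>.\<close>

lemma label_add:
  assumes "fst x \<in> {1..l}" "Suc k < m (fst x)"
  shows "label x k + label x (Suc k) =
    (if even (offset (fst x) + k) = snd x then 2 * M + 2 else 2 * M)"
proof -
  have k: "offset (fst x) + Suc k < M" "offset (fst x) + k < M"
    using position_less[OF assms(1), of "Suc k"] position_less[OF assms(1), of k] assms(2) by auto
  show ?thesis
    using evens_add[of "offset (fst x) + k"] evens_bounds(1)[OF k(1)] evens_bounds(1)[OF k(2)] k
    by (auto simp: label_def Let_def split: if_splits)
qed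

lemma label_complement:
  "i \<in> {1..l} \<Longrightarrow> k < m i \<Longrightarrow> label (i, True) k + label (i, False) k = 2 * M + 1"
  using evens_bounds(1)[OF position_less[of i k]] by (simp add: label_def)

section \<open>The labeling of the graph and its colours\<close>

definition f :: "'a set \<Rightarrow> nat" where
  "f e = (case the_inv_into (SIGMA p:P. {..<L p}) (\<lambda>(p, k). edge p k) e of
    (p, k) \<Rightarrow> label (pairing p) k)"

lemma f_edge: "p \<in> P \<Longrightarrow> k < L p \<Longrightarrow> f (edge p k) = label (pairing p) k"
  using the_inv_into_f_f[OF edge_inj, of "(p, k)"] by (simp add: f_def)

lemma fst_pairing: "p \<in> P \<Longrightarrow> fst (pairing p) \<in> {1..l}"
  using bij_betw_apply[OF pairing_bij, of p] by auto

lemma f_bij: "bij_betw f E {1..card E}"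
proof -
  have "inj_on f E"
  proof (rule inj_onI)
    fix e e' assume "e \<in> E" "e' \<in> E" and ff: "f e = f e'"
    then obtain p k q j where *: "p \<in> P" "k < L p" "e = edge p k" "q \<in> P" "j < L q" "e' = edge q j"
      unfolding edge_image[symmetric] by auto
    then have "label (pairing p) k = label (pairing q) j"
      using ff by (simp add: f_edge)
    then have "pairing p = pairing q \<and> k = j"
      by (intro label_inj) (use * fst_pairing m_pairing in auto)
    then show "e = e'"
      using * inj_onD[OF bij_betw_imp_inj_on[OF pairing_bij]] by auto
  qed
  moreover have "f ` E = {1..card E}"
  proof (rule card_subset_eq)
    show "f ` E \<subseteq> {1..card E}"
    proof
      fix a assume "a \<in> f ` E"
      then obtain p k where *: "p \<in> P" "k < L p" "a = f (edge p k)"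
        unfolding edge_image[symmetric] by auto
      then show "a \<in> {1..card E}"
        using label_bounds[OF fst_pairing[OF *(1)], of k] m_pairing[OF *(1)] card_E_M
        by (simp add: f_edge)
    qed
    show "card (f ` E) = card {1..card E}"
      using card_image[OF \<open>inj_on f E\<close>] by simp
  qed simp
  ultimately show ?thesis
    by (simp add: bij_betw_def)
qed

lemma m_pos: "i \<in> {1..l} \<Longrightarrow> m i \<ge> 2"
proof -
  assume "i \<in> {1..l}"
  then obtain p where "p \<in> P" "pairing p = (i, True)"
    using pairing_bij by (metis (no_types, lifting) SigmaI UNIV_I bij_betw_iff_bijections)
  then show "m i \<ge> 2"
    using m_pairing[of p] long[of p] by simp
qed

lemma f_u: "vertex_sum E f u = l * (2 * M + 1)"
proof -
  have "vertex_sum E f u = (\<Sum>p\<in>P. (\<lambda>x. label x 0) (pairing p))"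
    unfolding vertex_sum_u by (rule sum.cong) (use f_edge long in fastforce)+
  also have "\<dots> = (\<Sum>i=1..l. label (i, True) 0 + label (i, False) 0)"
    by (rule sum_pairing)
  also have "\<dots> = (\<Sum>i=1..l. 2 * M + 1)"
    by (rule sum.cong[OF refl]) (use label_complement m_pos in fastforce)
  finally show ?thesis by simp
qed

lemma f_v: "vertex_sum E f v = l * (2 * M + 1)"
proof -
  have "vertex_sum E f v = (\<Sum>p\<in>P. (\<lambda>x. label x (m (fst x) - 1)) (pairing p))"
    unfolding vertex_sum_v by (rule sum.cong) (use f_edge m_pairing long in fastforce)+
  also have "\<dots> = (\<Sum>i=1..l. label (i, True) (m i - 1) + label (i, False) (m i - 1))"
    by (subst sum_pairing) simp
  also have "\<dots> = (\<Sum>i=1..l. 2 * M + 1)"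
    by (rule sum.cong[OF refl]) (use label_complement m_pos in fastforce)
  finally show ?thesis by simp
qed

lemma f_inner:
  assumes "p \<in> P" "Suc k < L p"
  shows "vertex_sum E f (p ! Suc k) =
    (if even (offset (fst (pairing p)) + k) = snd (pairing p) then 2 * M + 2 else 2 * M)"
  using label_add[OF fst_pairing[OF assms(1)], of k] vertex_sum_inner[OF assms, of f]
    f_edge[OF assms(1)] m_pairing[OF assms(1)] assms(2) by simp

text \<open>For \<open>l = 1\<close> the number is odd; for \<open>l \<ge> 2\<close> it exceeds
  \<open>2 * M + 2\<close>.\<close>

lemma end_colour: "l * (2 * M + 1) \<noteq> 2 * M" "l * (2 * M + 1) \<noteq> 2 * M + 2"
proof -
  obtain p where "p \<in> P"
    using P_nonempty by blast
  then have l: "l \<ge> 1" and "M \<ge> 2"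
    using fst_pairing[of p] offset_le[of "fst (pairing p)"] m_pairing[of p] long[of p] by auto
  from l consider "l = 1" | "l \<ge> 2" by linarith
  then have "l * (2 * M + 1) \<noteq> 2 * M \<and> l * (2 * M + 1) \<noteq> 2 * M + 2"
  proof cases
    case 2
    have "2 * M + 2 < 2 * (2 * M + 1)"
      using \<open>M \<ge> 2\<close> by simp
    also have "\<dots> \<le> l * (2 * M + 1)"
      using 2 by (rule mult_le_mono1)
    finally have "2 * M + 2 < l * (2 * M + 1)" .
    moreover have "b + 2 < c \<Longrightarrow> c \<noteq> b \<and> c \<noteq> b + 2" for b c :: nat
      by auto
    ultimately show ?thesis by blast
  qed simp
  then show "l * (2 * M + 1) \<noteq> 2 * M" "l * (2 * M + 1) \<noteq> 2 * M + 2"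
    by auto
qed

lemma consecutive_colours:
  assumes "p \<in> P" "i < L p"
  shows "vertex_sum E f (p ! i) \<noteq> vertex_sum E f (p ! Suc i)"
proof -
  consider "i = 0" | "Suc i = L p" | j where "i = Suc j" "Suc i < L p"
    using assms(2) by (cases i) force+
  then show ?thesis
  proof cases
    case 1
    then show ?thesis
      using f_inner[OF assms(1), of 0] long[OF assms(1)] end_colour by (simp add: nth_0[OF assms(1)] f_u)
  next
    case 2
    then obtain j where j: "i = Suc j"
      using long[OF assms(1)] by (cases i) auto
    then show ?thesis
      using f_inner[OF assms(1), of j] 2 end_colour nth_last[OF assms(1)] f_v by auto
  next
    \<comment> \<open>Between two inner vertices the parity of the position flips, so
      \<open>2 * M\<close> and \<open>2 * M + 2\<close> alternate.\<close>
    case (3 j)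
    then show ?thesis
      using f_inner[OF assms(1), of j] f_inner[OF assms(1), of i] by auto
  qed
qed

lemma three_colours: "local_antimagic_labeling V E f" "num_colors V E f \<le> 3"
proof -
  show "local_antimagic_labeling V E f"
    unfolding local_antimagic_labeling_def
  proof (intro conjI ballI impI)
    show "vertex_sum E f y \<noteq> vertex_sum E f z" if "{y, z} \<in> E" for y z
      using adjacent_E[OF that] consecutive_colours by metis
  qed (rule f_bij)
  have "vertex_sum E f ` V \<subseteq> {2 * M, 2 * M + 2, l * (2 * M + 1)}"
  proof (rule image_subsetI)
    fix z assume "z \<in> V"
    then show "vertex_sum E f z \<in> {2 * M, 2 * M + 2, l * (2 * M + 1)}"
      by (cases rule: V_cases) (simp_all only: f_u f_v f_inner, auto)
  qed
  then have "num_colors V E f \<le> card {2 * M, 2 * M + 2, l * (2 * M + 1)}"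
    unfolding num_colors_def by (intro card_mono) auto
  also have "\<dots> \<le> 3"
  proof -
    have "card {a, b, c} \<le> 3" for a b c :: nat
      by (simp add: card_insert_if)
    then show ?thesis .
  qed
  finally show "num_colors V E f \<le> 3" .
qed

end

end

section \<open>The theorem\<close>

lemma bridge_graph_locale:
  assumes "is_bridge_graph V E M" "M \<noteq> {#}" "\<And>n. n \<in># M \<Longrightarrow> n \<ge> 2"
  obtains u v P where "bridge u v P V E" "image_mset path_length (mset_set P) = M"
proof -
  obtain u v P where *: "u \<noteq> v" "finite P" "\<forall>p\<in>P. path_between u v p"
    "\<forall>p\<in>P. \<forall>q\<in>P. p \<noteq> q \<longrightarrow> set p \<inter> set q = {u, v}"
    "image_mset path_length (mset_set P) = M"
    "V = {u, v} \<union> (\<Union>p\<in>P. set p)" "E = (\<Union>p\<in>P. path_edges p)"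
    using assms(1) unfolding is_bridge_graph_def by blast
  have "path_length p \<ge> 2" if "p \<in> P" for p
    using assms(3)[of "path_length p"] *(2) that unfolding *(5)[symmetric] by simp
  moreover have "P \<noteq> {}"
    using *(5) assms(2) by auto
  ultimately have "bridge u v P V E"
    using * by unfold_locales auto
  with *(5) that show thesis by blast
qed

lemma image_mset_const_on:
  assumes "finite A" "\<And>a. a \<in> A \<Longrightarrow> f a = c"
  shows "image_mset f (mset_set A) = replicate_mset (card A) c"
proof -
  have "image_mset f (mset_set A) = image_mset (\<lambda>_. c) (mset_set A)"
    using assms by (intro image_mset_cong) simp
  then show ?thesis
    by (simp add: image_mset_const_eq)
qed

theorem theorem3p5:
  fixes V :: "'a set" and E :: "'a set set" and l :: nat and m :: "nat \<Rightarrow> nat"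
  assumes "l \<ge> 1"
    and "2 \<le> m 1"
    and "\<forall>i\<in>{1..l}. \<forall>j\<in>{1..l}. i \<le> j \<longrightarrow> m i \<le> m j"
    and "is_bridge_graph V E (\<Sum>i=1..l. replicate_mset 2 (m i))"
    and not_0: "\<not> (\<exists>s. even s \<and> s \<ge> 4 \<and> is_bridge_graph V E (replicate_mset s 2))"
    and not_1: "\<not> (\<exists>t\<ge>1. is_bridge_graph V E
      (replicate_mset (3 * t + 2) (4 * t) + replicate_mset t (4 * t + 2)))"
    and not_2a: "\<not> (\<exists>t\<ge>2. is_bridge_graph V E
      ({#2 * t - 2#} + replicate_mset (3 * t - 1) (4 * t - 2)))"
    and not_2b: "\<not> is_bridge_graph V E ({#2#} + replicate_mset 3 4 + {#6#})"
      "\<not> is_bridge_graph V E ({#4#} + replicate_mset 5 8 + replicate_mset 2 10)"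
      "\<not> is_bridge_graph V E ({#6#} + replicate_mset 7 12 + replicate_mset 3 14)"
    and not_3a: "\<not> (\<exists>t p :: nat. 2 \<le> t \<and> t \<le> p \<and> real p \<le> (5 * real t - 2) / 4 \<and>
      is_bridge_graph V E ({#4 * t - 2 - 2 * p, 2 * p#} +
        replicate_mset t (4 * t - 4) + replicate_mset (t - 2) (4 * t - 2)))"
    and not_3b: "\<not> (\<exists>t p :: nat. 2 \<le> t \<and> t \<le> p \<and> real p \<le> 5 * real t / 4 \<and>
      is_bridge_graph V E ({#4 * t - 2 - 2 * p, 2 * p - 2#} +
        replicate_mset (t - 1) (4 * t - 4) + replicate_mset (t - 1) (4 * t - 2)))"
    and not_4: "\<not> (\<exists>s p :: nat. s \<ge> 4 \<and>
      (2 * real s - 3) / 8 \<le> real p \<and> real p \<le> (6 * real s - 5) / 8 \<and>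
      is_bridge_graph V E ({#2 * p, 4 * s - 6 - 2 * p, 2 * s - 4#} +
        replicate_mset (s - 3) (4 * s - 6)))"
  shows "chi_la V E = 3"
proof -
  let ?M = "\<Sum>i=1..l. replicate_mset 2 (m i)"
  have long: "n \<ge> 2" if n: "n \<in># ?M" for n
  proof -
    obtain i where i: "i \<in> {1..l}" "n = m i"
      using n by (auto simp: set_mset_sum)
    then have "m 1 \<le> m i"
      using assms(1,3) by auto
    then show ?thesis
      using i assms(2) by simp
  qed
  have "size ?M = 2 * l"
    by (induction l) auto
  then have "?M \<noteq> {#}"
    using assms(1) by (metis size_empty mult_is_0 not_one_le_zero zero_neq_numeral)
  then obtain u v P where B: "bridge u v P V E" and M: "image_mset path_length (mset_set P) = ?M"
    using bridge_graph_locale[OF assms(4) _ long] by blast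
  interpret bridge u v P V E
    by (rule B)
  have "chi_la V E \<le> enat (num_colors V E (f l m))"
    unfolding chi_la_def using three_colours(1)[OF M] by (intro INF_lower) simp
  also have "\<dots> \<le> 3"
    using three_colours(2)[OF M] by (simp add: numeral_eq_enat)
  finally have upper: "chi_la V E \<le> 3" .
  have "3 \<le> num_colors V E g" if g: "local_antimagic_labeling V E g" for g
  proof (rule ccontr)
    assume "\<not> 3 \<le> num_colors V E g"
    then have two: "num_colors V E g \<le> 2" by simp
    have parity: "even (card {p \<in> P. L p = n})" for n
    proof -
      have "card {p \<in> P. L p = n} = count ?M n"
        unfolding M[symmetric] by (rule count_image_mset_set[OF finite_P, symmetric])
      also have "even \<dots>"
        by (simp add: count_sum dvd_sum)
      finally show ?thesis .
    qed
    from two_colour_lengths[OF g two parity]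
    consider "card P \<ge> 4" "\<forall>p\<in>P. L p = 2"
      | t where "t \<ge> 1" "?M = replicate_mset (3 * t + 2) (4 * t) + replicate_mset t (4 * t + 2)"
      | t where "t \<ge> 2" "?M = {#2 * t - 2, 2 * t - 2#} +
          replicate_mset (t - 1) (4 * t - 4) + replicate_mset (t - 1) (4 * t - 2)"
      unfolding M by blast
    then show False
    proof cases
      case 1
      have "?M = replicate_mset (card P) 2"
        unfolding M[symmetric] using 1(2) finite_P by (intro image_mset_const_on) auto
      moreover have "even (card P)"
        by (rule even_card_of_fibres[OF finite_P parity])
      ultimately show False
        using not_0 1(1) assms(4) by auto
    next
      case (2 t)
      then show False
        using not_1 assms(4) by auto
    next
      case (3 t)
      \<comment> \<open>For \<open>p = t\<close> the entry \<open>4 * t - 2 - 2 * p\<close> equals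
        \<open>2 * t - 2\<close>, so this is family (3b).\<close>
      then have "?M = {#4 * t - 2 - 2 * t, 2 * t - 2#} +
          replicate_mset (t - 1) (4 * t - 4) + replicate_mset (t - 1) (4 * t - 2)"
        by (simp add: algebra_simps)
      then have "is_bridge_graph V E ({#4 * t - 2 - 2 * t, 2 * t - 2#} +
          replicate_mset (t - 1) (4 * t - 4) + replicate_mset (t - 1) (4 * t - 2))"
        using assms(4) by simp
      moreover have "2 \<le> t \<and> t \<le> t \<and> real t \<le> 5 * real t / 4"
        using 3(1) by simp
      ultimately show False
        using not_3b by blast
    qed
  qed
  then have "3 \<le> chi_la V E"
    unfolding chi_la_def by (intro INF_greatest) (simp add: numeral_eq_enat)
  with upper show ?thesis
    by (rule antisym)
qed

end
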